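(* There exists a family of Boolean functions $(f_k)_{k\ge1}$, $f_k:\{0,1\}^{N_k}\to\{0,1\}$ with $N_k$ strictly increasing, that can be computed by $\mathsf{MAJ}\circ\mathsf{MAJ}$ circuits of size polynomial in $N_k$, but any linear decision list computing $f_k$ requires size exponential in $N_k$, i.e. $2^{\Omega(N_k)}$.
   Context: Define $\mathrm{sign}:\mathbb{R}\to\{0,1\}$ by $\mathrm{sign}(x)=1$ if $x>0$ and $\mathrm{sign}(x)=0$ if $x\le 0$. A function $f:\{0,1\}^N\to\{0,1\}$ is a linear threshold function (LTF) if there are real numbers $w_0,w_1,\dots,w_N$ with $f(x)=\mathrm{sign}(w_0+\sum_{i=1}^N w_ix_i)$ for all $x$. A linear decision list of size $k$ on $N$ variables is a sequence $(L_1,a_1),\dots,(L_k,a_k)$ where each $a_i\in\{0,1\}$, each $L_i$ is an LTF on $\{0,1\}^N$ (arbitrary real weights), and $L_k$ is the constant function $1$. It computes the function $f$ given by $f(x)=a_i$, where $i$ is the least index with $L_i(x)=1$. A $\mathsf{MAJ}$ gate with $m$ inputs computes $\mathsf{MAJ}_m(z)=\mathrm{sign}(z_1+\dots+z_m-m/2)$; each input to the gate may be a constant $0$ or $1$, or an input bit, or the negation of an input bit, with repetitions allowed. A $\mathsf{MAJ}\circ\mathsf{MAJ}$ circuit is a depth-2 circuit with a $\mathsf{MAJ}$ gate at the top whose input bits are the outputs of bottom-layer $\mathsf{MAJ}$ gates, which in turn act on the variables; its size is the total number of wires, counted with multiplicity. *)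

theory Defs
  imports Complex_Main "HOL-Computational_Algebra.Polynomial"
begin

text \<open>Points of the cube \<open>{0,1}\<^sup>N\<close> are Boolean lists of length \<open>N\<close>, with \<open>True\<close> for \<open>1\<close>; variables are
  numbered from \<open>0\<close>. Functions on the cube are functions on all Boolean lists whose values at
  lists of other lengths are irrelevant.\<close>

definition cube :: "nat \<Rightarrow> bool list set" where
  "cube N = {x. length x = N}"

definition sign01 :: "real \<Rightarrow> bool" where
  "sign01 r \<longleftrightarrow> r > 0"

definition is_LTF :: "nat \<Rightarrow> (bool list \<Rightarrow> bool) \<Rightarrow> bool" where
  "is_LTF N f \<longleftrightarrow>
     (\<exists>(w0 :: real) (w :: nat \<Rightarrow> real).
        \<forall>x \<in> cube N. f x = sign01 (w0 + (\<Sum>i<N. w i * of_bool (x ! i))))"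

type_synonym decision_list = "((bool list \<Rightarrow> bool) \<times> bool) list"

definition is_linear_decision_list :: "nat \<Rightarrow> decision_list \<Rightarrow> bool" where
  "is_linear_decision_list N D \<longleftrightarrow>
     D \<noteq> [] \<and> (\<forall>(L, a) \<in> set D. is_LTF N L) \<and> (\<forall>x \<in> cube N. fst (last D) x)"

definition decision_list_eval :: "decision_list \<Rightarrow> bool list \<Rightarrow> bool" where
  "decision_list_eval D x = snd (D ! (LEAST i. i < length D \<and> fst (D ! i) x))"

definition linear_decision_list_computes ::
  "nat \<Rightarrow> decision_list \<Rightarrow> (bool list \<Rightarrow> bool) \<Rightarrow> bool" where
  "linear_decision_list_computes N D f \<longleftrightarrow>
     is_linear_decision_list N D \<and> (\<forall>x \<in> cube N. decision_list_eval D x = f x)"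

definition MAJ :: "bool list \<Rightarrow> bool" where
  "MAJ z = sign01 ((\<Sum>b\<leftarrow>z. of_bool b) - real (length z) / 2)"

datatype gate_input = In_const bool | In_bit nat | In_neg nat

type_synonym maj_gate = "gate_input list"

fun input_over :: "nat \<Rightarrow> gate_input \<Rightarrow> bool" where
  "input_over n (In_const b) = True"
| "input_over n (In_bit i) = (i < n)"
| "input_over n (In_neg i) = (i < n)"

fun input_val :: "bool list \<Rightarrow> gate_input \<Rightarrow> bool" where
  "input_val x (In_const b) = b"
| "input_val x (In_bit i) = x ! i"
| "input_val x (In_neg i) = (\<not> x ! i)"

definition gate_over :: "nat \<Rightarrow> maj_gate \<Rightarrow> bool" where
  "gate_over n g \<longleftrightarrow> (\<forall>u \<in> set g. input_over n u)"

definition gate_val :: "bool list \<Rightarrow> maj_gate \<Rightarrow> bool" where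
  "gate_val x g = MAJ (map (input_val x) g)"

text \<open>A circuit consists of its bottom gates and its top gate. The bits of the top gate are
  indices into the list of bottom gates, so a bottom gate may feed the top gate several times
  while its own input wires are counted once.\<close>

type_synonym maj_maj_circuit = "maj_gate list \<times> maj_gate"

definition is_circuit :: "nat \<Rightarrow> maj_maj_circuit \<Rightarrow> bool" where
  "is_circuit N C \<longleftrightarrow>
     (\<forall>g \<in> set (fst C). gate_over N g) \<and> gate_over (length (fst C)) (snd C)"

definition circuit_eval :: "maj_maj_circuit \<Rightarrow> bool list \<Rightarrow> bool" where
  "circuit_eval C x = gate_val (map (gate_val x) (fst C)) (snd C)"

text \<open>Constant inputs count as wires.\<close>

definition circuit_size :: "maj_maj_circuit \<Rightarrow> nat" where
  "circuit_size C = (\<Sum>g\<leftarrow>fst C. length g) + length (snd C)"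

definition circuit_computes :: "nat \<Rightarrow> maj_maj_circuit \<Rightarrow> (bool list \<Rightarrow> bool) \<Rightarrow> bool" where
  "circuit_computes N C f \<longleftrightarrow> is_circuit N C \<and> (\<forall>x \<in> cube N. circuit_eval C x = f x)"

end

theory Submission
  imports Defs
begin

text \<open>The function compares the Hamming distance of the two halves of its input with half their
  length. A linear decision list with \<open>l\<close> queries has a monochromatic rectangle with sides of
  about \<open>2\<^sup>k / l\<close> points: each query compares a sum \<open>a x + b y\<close> with \<open>0\<close>, so either it is true
  on the rectangle of the points with the largest \<open>a\<close> and \<open>b\<close>, or it is false outside these rows
  and columns, which can then be removed. On the other hand, the points of a monochromatic
  rectangle have pairwise distance at least \<open>k / 2\<close>, after complementing one side if the value is
  \<open>0\<close>, and sets so far apart are exponentially small.\<close>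

section \<open>Sets at large Hamming distance\<close>

definition hdist :: "bool list \<Rightarrow> bool list \<Rightarrow> nat" where
  "hdist x y = (\<Sum>(a, b)\<leftarrow>zip x y. of_bool (a \<noteq> b))"

lemma hdist_Nil [simp]: "hdist [] y = 0"
  by (simp add: hdist_def)

lemma hdist_Cons [simp]: "hdist (a # x) (b # y) = of_bool (a \<noteq> b) + hdist x y"
  by (simp add: hdist_def)

lemma hdist_map_Not:
  assumes "length x = length y"
  shows "hdist x (map Not y) + hdist x y = length x"
  using assms by (induction x y rule: list_induct2) auto

lemma hdist_conv_sum:
  assumes "length x = length y"
  shows "hdist x y = (\<Sum>i<length x. of_bool (x ! i \<noteq> y ! i))"
  using assms by (simp add: hdist_def sum_list_sum_nth atLeast0LessThan)

lemma finite_cube [simp]: "finite (cube n)"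
  using finite_lists_length_eq[of "UNIV :: bool set" n] by (simp add: cube_def)

lemma card_cube: "card (cube n) = 2 ^ n"
  using card_lists_length_eq[of "UNIV :: bool set" n] by (simp add: cube_def)

lemma card_cube_Suc_split:
  assumes "A \<subseteq> cube (Suc n)"
  shows "card A = card {x. True # x \<in> A} + card {x. False # x \<in> A}"
proof -
  have fin: "finite A"
    using assms finite_cube finite_subset by blast
  have A: "A = (#) True ` {x. True # x \<in> A} \<union> (#) False ` {x. False # x \<in> A}"
  proof
    show "A \<subseteq> (#) True ` {x. True # x \<in> A} \<union> (#) False ` {x. False # x \<in> A}"
    proof
      fix z assume z: "z \<in> A"
      then have "length z = Suc n"
        using assms by (auto simp: cube_def)
      then obtain b x where "z = b # x"
        by (cases z) auto
      with z show "z \<in> (#) True ` {x. True # x \<in> A} \<union> (#) False ` {x. False # x \<in> A}"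
        by (cases b) auto
    qed
  qed auto
  have "card A = card ((#) True ` {x. True # x \<in> A}) + card ((#) False ` {x. False # x \<in> A})"
    by (subst A, rule card_Un_disjoint) (use fin A in \<open>auto intro: finite_subset\<close>)
  then show ?thesis
    by (simp add: card_image)
qed

text \<open>For \<open>r > m\<close>, \<open>r + s\<close> is at most \<open>r + m * m / r\<close>,
  which is convex in \<open>r\<close> and equals \<open>10 / 3 * m\<close> at both
  \<open>r = 3 * m\<close> and \<open>r = m / 3\<close>; hence the factors of the product in the
  proof. For \<open>r \<le> m\<close> already \<open>r + s \<le> 2 * m\<close>.\<close>

lemma add_le_of_prod_le:
  fixes r s m :: real
  assumes "0 \<le> s" "r \<le> 3 * m" "s \<le> r" "r * s \<le> m * m" "0 \<le> m"
  shows "r + s \<le> 10 / 3 * m"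
proof (cases "r \<le> m \<or> r = 0")
  case True
  with assms show ?thesis
    by auto
next
  case False
  with assms have r: "m < r" "0 < r"
    by auto
  have "(r - 3 * m) * (r - m / 3) \<le> 0"
    using assms r by (intro mult_nonpos_nonneg) auto
  then have "r * r + m * m \<le> r * (10 / 3 * m)"
    by (simp add: algebra_simps)
  with assms(4) have "r * (r + s) \<le> r * (10 / 3 * m)"
    by (simp add: algebra_simps)
  then show ?thesis
    using r(2) by (simp only: mult_le_cancel_left_pos)
qed

text \<open>The induction splits off the first coordinate. The bounds for the four pairs of halves alone
  do not suffice: one also needs that the two products of halves with equal first bit and the two
  with different first bit have the same product.\<close>

lemma card_mult_card_le_of_hdist:
  assumes "A \<subseteq> cube n" "B \<subseteq> cube n" "\<And>x y. x \<in> A \<Longrightarrow> y \<in> B \<Longrightarrow> d \<le> hdist x y"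
  shows "real (card A) * real (card B) * 3 ^ d \<le> (16 / 3) ^ n"
  using assms
proof (induction n arbitrary: A B d)
  case 0
  have A: "card A \<le> 1" and B: "card B \<le> 1"
    using card_mono[OF finite_cube 0(1)] card_mono[OF finite_cube 0(2)] by (auto simp: card_cube)
  show ?case
  proof (cases "A = {} \<or> B = {}")
    case False
    then obtain x y where "x \<in> A" "y \<in> B"
      by auto
    with 0 have "d \<le> hdist x y" "x = []"
      by (auto simp: cube_def)
    then have "d = 0"
      by simp
    with A B show ?thesis
      by (simp add: mult_le_one)
  qed auto
next
  case (Suc n)
  let ?A = "\<lambda>b. {x. b # x \<in> A}" and ?B = "\<lambda>b. {x. b # x \<in> B}"
  have sub: "?A b \<subseteq> cube n" "?B b \<subseteq> cube n" for b
    using Suc.prems(1,2) by (auto simp: cube_def)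
  show ?case
  proof (cases d)
    case 0
    have "card A \<le> 2 ^ Suc n" "card B \<le> 2 ^ Suc n"
      using card_mono[OF finite_cube Suc.prems(1)] card_mono[OF finite_cube Suc.prems(2)]
      by (simp_all only: card_cube)
    then have "card A * card B \<le> 2 ^ Suc n * 2 ^ Suc n"
      by (rule mult_mono) auto
    also have "\<dots> = 4 ^ Suc n"
      by (simp only: power_mult_distrib[symmetric]) simp
    finally have "real (card A * card B) \<le> real (4 ^ Suc n)"
      by (simp only: of_nat_le_iff)
    also have "\<dots> \<le> (16 / 3) ^ Suc n"
      unfolding of_nat_power by (rule power_mono) auto
    finally show ?thesis
      using 0 by simp
  next
    case (Suc e)
    define M :: real where "M = (16 / 3) ^ n"
    define T :: real where "T = 3 ^ d"
    define a b where "a i = real (card (?A i))" and "b i = real (card (?B i))" for i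
    have M: "0 \<le> M" and ab: "0 \<le> a i" "0 \<le> b i" and T: "0 \<le> T" for i
      by (auto simp: M_def T_def a_def b_def)
    \<comment> \<open>Equal first bits contribute nothing, so the tails keep distance
      \<open>d\<close>.\<close>
    have eq: "a i * b i * T \<le> M" for i
      unfolding a_def b_def M_def T_def
      by (rule Suc.IH) (use sub Suc.prems(3) in force)+
    \<comment> \<open>Different first bits account for one unit of distance: the tails are only
      known to be at distance \<open>e = d - 1\<close>, which costs a factor 3.\<close>
    have ne: "a i * b j * T \<le> 3 * M" if "i \<noteq> j" for i j
    proof -
      have "e \<le> hdist x y" if "x \<in> ?A i" "y \<in> ?B j" for x y
        using Suc.prems(3)[of "i # x" "j # y"] that \<open>i \<noteq> j\<close> Suc by auto
      then have "a i * b j * 3 ^ e \<le> M"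
        unfolding a_def b_def M_def by (intro Suc.IH sub)
      then show ?thesis
        by (simp add: T_def Suc)
    qed
    define r s where "r = a True * b False * T" and "s = a False * b True * T"
    have rs: "0 \<le> r" "0 \<le> s" "r \<le> 3 * M" "s \<le> 3 * M"
      using ab T ne[of True False] ne[of False True] by (auto simp: r_def s_def)
    have "(a True * b True * T) * (a False * b False * T) \<le> M * M"
      using eq M ab T by (intro mult_mono) auto
    then have "r * s \<le> M * M"
      by (simp add: r_def s_def mult_ac)
    then have "r + s \<le> 10 / 3 * M"
      using add_le_of_prod_le[of s r M] add_le_of_prod_le[of r s M] rs M
      by (cases "s \<le> r") (auto simp: mult.commute add.commute)
    \<comment> \<open>The constant is \<open>1 + 1 + 10 / 3\<close>: two products with equal first
      bits and the two mixed ones together.\<close>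
    then have "(a True + a False) * (b True + b False) * T \<le> 16 / 3 * M"
      using eq[of True] eq[of False] by (simp add: r_def s_def algebra_simps)
    then show ?thesis
      using Suc.prems(1,2) by (simp add: card_cube_Suc_split a_def b_def M_def T_def)
  qed
qed

section \<open>Monochromatic rectangles of linear decision lists\<close>

lemma ex_subset_of_largest:
  fixes f :: "'a \<Rightarrow> real"
  assumes "finite X" "s \<le> card X"
  shows "\<exists>T\<subseteq>X. card T = s \<and> (\<forall>x\<in>T. \<forall>y\<in>X - T. f y \<le> f x)"
  using assms(2)
proof (induction s)
  case 0
  show ?case
    by (intro exI[of _ "{}"]) auto
next
  case (Suc s)
  then obtain T where T: "T \<subseteq> X" "card T = s" "\<forall>x\<in>T. \<forall>y\<in>X - T. f y \<le> f x"
    by auto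
  have fin: "finite (X - T)" and finT: "finite T"
    using assms T(1) finite_subset by auto
  have "X - T \<noteq> {}"
    using T Suc.prems card_mono[OF finT, of X] by auto
  with fin have "Max (f ` (X - T)) \<in> f ` (X - T)"
    by (intro Max_in) auto
  with fin obtain z where z: "z \<in> X - T" "\<forall>y\<in>X - T. f y \<le> f z"
    by (metis Max_ge finite_imageI imageE imageI)
  show ?case
    using T z finT by (intro exI[of _ "insert z T"]) auto
qed

text \<open>If the first query fails, the least index shifts by one. This needs a later query that
  is true, as \<open>LEAST\<close> over an empty set of indices is unspecified.\<close>

lemma decision_list_eval_Cons:
  assumes "\<not> fst p x \<Longrightarrow> \<exists>q\<in>set D. fst q x"
  shows "decision_list_eval (p # D) x = (if fst p x then snd p else decision_list_eval D x)"
proof (cases "fst p x")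
  case True
  then have "(LEAST i. i < length (p # D) \<and> fst ((p # D) ! i) x) = 0"
    by (intro Least_eq_0) auto
  with True show ?thesis
    by (simp add: decision_list_eval_def)
next
  case False
  with assms obtain j where "j < length D" "fst (D ! j) x"
    by (metis in_set_conv_nth)
  then have "(LEAST i. i < length (p # D) \<and> fst ((p # D) ! i) x) =
      Suc (LEAST i. Suc i < length (p # D) \<and> fst ((p # D) ! Suc i) x)"
    by (intro Least_Suc[of _ "Suc j"]) (use False in auto)
  with False show ?thesis
    by (simp add: decision_list_eval_def)
qed

lemma is_LTF_append:
  assumes "is_LTF (m + n) L"
  shows "\<exists>a b. \<forall>x\<in>cube m. \<forall>y\<in>cube n. L (x @ y) \<longleftrightarrow> a x + b y > (0 :: real)"
proof -
  from assms obtain w0 w where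
    L: "\<And>z. z \<in> cube (m + n) \<Longrightarrow> L z = sign01 (w0 + (\<Sum>i<m + n. w i * of_bool (z ! i)))"
    unfolding is_LTF_def by blast
  have split: "(\<Sum>i<m + n. g i) = (\<Sum>i<m. g i) + (\<Sum>i<n. g (m + i))" for g :: "nat \<Rightarrow> real"
    by (induction n) auto
  show ?thesis
  proof (intro exI ballI)
    fix x y assume "x \<in> cube m" "y \<in> cube n"
    then have "length x = m" "x @ y \<in> cube (m + n)"
      by (auto simp: cube_def)
    with L[of "x @ y"]
    show "L (x @ y) \<longleftrightarrow> (w0 + (\<Sum>i<m. w i * of_bool (x ! i))) +
        (\<Sum>i<n. w (m + i) * of_bool (y ! i)) > 0"
      by (simp add: sign01_def split nth_append add.assoc del: sum_mult_of_bool_eq)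
  qed
qed

text \<open>Each query that fails somewhere on its top rectangle costs \<open>s\<close> rows and
  \<open>s\<close> columns, and \<open>length D * s\<close> pays for this. That some query is true
  at every point passes to the tail of the list, because the first query is false on the remaining
  rectangle; so a single remaining query must be true on all of it.\<close>

lemma decision_list_monochromatic_rectangle:
  assumes "D \<noteq> []" "finite X" "finite Y" "X \<subseteq> cube m" "Y \<subseteq> cube n"
    and "\<forall>p\<in>set D. is_LTF (m + n) (fst p)"
    and "length D * s \<le> card X" "length D * s \<le> card Y"
    and "\<forall>x\<in>X. \<forall>y\<in>Y. \<exists>p\<in>set D. fst p (x @ y)"
  shows "\<exists>A B v. A \<subseteq> X \<and> B \<subseteq> Y \<and> card A = s \<and> card B = s \<and>
           (\<forall>x\<in>A. \<forall>y\<in>B. decision_list_eval D (x @ y) = v)"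
  using assms
proof (induction D arbitrary: X Y rule: list_nonempty_induct)
  case (single p)
  \<comment> \<open>A constant weight just selects some \<open>s\<close> points.\<close>
  obtain A where A: "A \<subseteq> X" "card A = s"
    using ex_subset_of_largest[of X s "\<lambda>_. 0"] single by auto
  obtain B where B: "B \<subseteq> Y" "card B = s"
    using ex_subset_of_largest[of Y s "\<lambda>_. 0"] single by auto
  have "decision_list_eval [p] (x @ y) = snd p" if "x \<in> A" "y \<in> B" for x y
  proof -
    have "fst p (x @ y)"
      using that A(1) B(1) single.prems(8) by auto
    then show ?thesis
      using decision_list_eval_Cons[of p "x @ y" "[]"] by simp
  qed
  with A B have "A \<subseteq> X \<and> B \<subseteq> Y \<and> card A = s \<and> card B = s \<and>
      (\<forall>x\<in>A. \<forall>y\<in>B. decision_list_eval [p] (x @ y) = snd p)"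
    by simp
  then show ?case
    by (intro exI)
next
  case (cons p D)
  have "is_LTF (m + n) (fst p)"
    using cons.prems(5) by simp
  from is_LTF_append[OF this] obtain a b where L:
    "\<forall>x\<in>cube m. \<forall>y\<in>cube n. fst p (x @ y) \<longleftrightarrow> a x + b y > (0 :: real)"
    by (elim exE)
  obtain A where A: "A \<subseteq> X" "card A = s" "\<forall>x\<in>A. \<forall>y\<in>X - A. a y \<le> a x"
    using ex_subset_of_largest[of X s a] cons.prems by auto
  obtain B where B: "B \<subseteq> Y" "card B = s" "\<forall>x\<in>B. \<forall>y\<in>Y - B. b y \<le> b x"
    using ex_subset_of_largest[of Y s b] cons.prems by auto
  have eval: "decision_list_eval (p # D) (x @ y) =
      (if fst p (x @ y) then snd p else decision_list_eval D (x @ y))" if "x \<in> X" "y \<in> Y" for x y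
    using cons.prems(8) that by (intro decision_list_eval_Cons) auto
  show ?case
  proof (cases "\<forall>x\<in>A. \<forall>y\<in>B. fst p (x @ y)")
    case True
    then have "decision_list_eval (p # D) (x @ y) = snd p" if "x \<in> A" "y \<in> B" for x y
      using A(1) B(1) eval[of x y] that by auto
    with A B have "A \<subseteq> X \<and> B \<subseteq> Y \<and> card A = s \<and> card B = s \<and>
        (\<forall>x\<in>A. \<forall>y\<in>B. decision_list_eval (p # D) (x @ y) = snd p)"
      by simp
    then show ?thesis
      by (intro exI)
  next
    case False
    then obtain t u where tu: "t \<in> A" "u \<in> B" "\<not> fst p (t @ u)"
      by blast
    have "t \<in> cube m" "u \<in> cube n"
      using tu A(1) B(1) cons.prems(3,4) by auto
    with L tu(3) have neg: "a t + b u \<le> 0"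
      by force
    \<comment> \<open>One failure at \<open>(t, u)\<close> inside \<open>A\<close> and
      \<open>B\<close> suffices: points outside have smaller or equal weights.\<close>
    have no: "\<not> fst p (x @ y)" if "x \<in> X - A" "y \<in> Y - B" for x y
    proof -
      have "a x \<le> a t" "b y \<le> b u"
        using that tu A(3) B(3) by auto
      with neg have "\<not> a x + b y > 0"
        by linarith
      moreover have "x \<in> cube m" "y \<in> cube n"
        using that cons.prems(3,4) by auto
      ultimately show ?thesis
        using L by blast
    qed
    have cards: "card (X - A) = card X - s" "card (Y - B) = card Y - s"
      using A B cons.prems(1,2) by (auto simp: card_Diff_subset finite_subset)
    have "\<exists>A' B' v. A' \<subseteq> X - A \<and> B' \<subseteq> Y - B \<and> card A' = s \<and> card B' = s \<and>
        (\<forall>x\<in>A'. \<forall>y\<in>B'. decision_list_eval D (x @ y) = v)"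
    proof (rule cons.IH)
      show "\<forall>x\<in>X - A. \<forall>y\<in>Y - B. \<exists>p\<in>set D. fst p (x @ y)"
        using cons.prems(8) no by fastforce
    qed (use cons.prems cards in auto)
    then obtain A' B' v where AB: "A' \<subseteq> X - A" "B' \<subseteq> Y - B" "card A' = s" "card B' = s"
      "\<forall>x\<in>A'. \<forall>y\<in>B'. decision_list_eval D (x @ y) = v"
      by blast
    have "decision_list_eval (p # D) (x @ y) = v" if "x \<in> A'" "y \<in> B'" for x y
    proof -
      have "x \<in> X - A" "y \<in> Y - B"
        using AB(1,2) that by auto
      then show ?thesis
        using eval[of x y] no[of x y] AB(5) that by simp
    qed
    with AB have "A' \<subseteq> X \<and> B' \<subseteq> Y \<and> card A' = s \<and> card B' = s \<and>
        (\<forall>x\<in>A'. \<forall>y\<in>B'. decision_list_eval (p # D) (x @ y) = v)"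
      by auto
    then show ?thesis
      by (intro exI)
  qed
qed

section \<open>The Hamming distance threshold\<close>

definition halves_far :: "nat \<Rightarrow> bool list \<Rightarrow> bool" where
  "halves_far k z \<longleftrightarrow> k < 2 * hdist (take k z) (drop k z)"

text \<open>Since \<open>[a \<noteq> b] = OR a b + NAND a b - 1\<close>, and \<open>OR\<close> and \<open>NAND\<close> are majorities of three
  bits one of which is constant, the distance of the halves plus \<open>k\<close> is a sum of \<open>2 k\<close> bottom
  gates; \<open>k\<close> constant inputs \<open>0\<close> move the threshold of the top gate to \<open>3 k / 2\<close>.\<close>

definition far_circuit :: "nat \<Rightarrow> maj_maj_circuit" where
  "far_circuit k =
     (map (\<lambda>i. [In_bit i, In_bit (k + i), In_const True]) [0..<k] @
      map (\<lambda>i. [In_neg i, In_neg (k + i), In_const True]) [0..<k],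
      map In_bit [0..<2 * k] @ replicate k (In_const False))"

lemma circuit_size_far: "circuit_size (far_circuit k) = 9 * k"
  by (simp add: circuit_size_def far_circuit_def comp_def sum_list_triv)

lemma MAJ_three: "MAJ [a, b, True] \<longleftrightarrow> a \<or> b"
  by (simp add: MAJ_def sign01_def)

lemma circuit_computes_far: "circuit_computes (2 * k) (far_circuit k) (halves_far k)"
  unfolding circuit_computes_def
proof (intro conjI ballI)
  show "is_circuit (2 * k) (far_circuit k)"
    by (auto simp: is_circuit_def far_circuit_def gate_over_def)
next
  fix z assume "z \<in> cube (2 * k)"
  then have len: "length z = 2 * k"
    by (simp add: cube_def)
  let ?b = "map (gate_val z) (fst (far_circuit k))"
  have b: "?b = map (\<lambda>i. z ! i \<or> z ! (k + i)) [0..<k] @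
      map (\<lambda>i. \<not> z ! i \<or> \<not> z ! (k + i)) [0..<k]"
    by (simp add: far_circuit_def gate_val_def MAJ_three)
  have bits: "map (input_val c) (map In_bit [0..<length c] @ replicate j (In_const False)) =
      c @ replicate j False" for c j
    by (simp add: comp_def map_nth)
  have "length ?b = 2 * k"
    by (simp add: far_circuit_def)
  then have "map (input_val ?b) (snd (far_circuit k)) = ?b @ replicate k False"
    using bits[of ?b k] by (simp only: far_circuit_def snd_conv)
  then have eval: "circuit_eval (far_circuit k) z = MAJ (?b @ replicate k False)"
    by (simp add: circuit_eval_def gate_val_def)
  have "hdist (take k z) (drop k z) = (\<Sum>i<k. of_bool (z ! i \<noteq> z ! (k + i)))"
    using len by (subst hdist_conv_sum) (auto intro!: sum.cong)
  then have "real k + real (hdist (take k z) (drop k z)) =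
      (\<Sum>i<k. 1 + of_bool (z ! i \<noteq> z ! (k + i)))"
    by (simp add: sum.distrib)
  also have "\<dots> = (\<Sum>i<k. of_bool (z ! i \<or> z ! (k + i)) + of_bool (\<not> z ! i \<or> \<not> z ! (k + i)))"
    by (rule sum.cong) auto
  also have "\<dots> = (\<Sum>c\<leftarrow>?b @ replicate k False. of_bool c)"
    unfolding b
    by (simp add: comp_def sum.distrib interv_sum_list_conv_sum_set_nat atLeast0LessThan
        map_replicate_const sum_list_replicate)
  finally have "circuit_eval (far_circuit k) z \<longleftrightarrow>
      0 < real k + real (hdist (take k z) (drop k z)) - real (3 * k) / 2"
    unfolding eval MAJ_def sign01_def by (simp add: b)
  also have "\<dots> \<longleftrightarrow> halves_far k z"
    unfolding halves_far_def by linarith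
  finally show "circuit_eval (far_circuit k) z = halves_far k z" .
qed

section \<open>Lower bound for decision lists computing the distance threshold\<close>

lemma halves_far_monochromatic_rectangle:
  assumes "A \<subseteq> cube k" "B \<subseteq> cube k" "\<forall>x\<in>A. \<forall>y\<in>B. halves_far k (x @ y) = v"
  shows "real (card A) * real (card B) * 3 ^ ((k + 1) div 2) \<le> (16 / 3) ^ k"
proof (cases v)
  case True
  have "(k + 1) div 2 \<le> hdist x y" if "x \<in> A" "y \<in> B" for x y
  proof -
    have "length x = k"
      using that assms(1) by (auto simp: cube_def)
    then have "k < 2 * hdist x y"
      using assms(3) that True by (auto simp: halves_far_def)
    then show ?thesis
      by linarith
  qed
  then show ?thesis
    by (rule card_mult_card_le_of_hdist[OF assms(1,2)])
next
  case False
  have "inj (map Not)"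
    by (rule inj_mapI) (auto simp: inj_def)
  then have card: "card (map Not ` B) = card B"
    by (meson card_image inj_on_subset subset_UNIV)
  \<comment> \<open>Complementing turns a distance of at most \<open>k / 2\<close> into one of at
    least \<open>k / 2\<close>, rounded up.\<close>
  have "(k + 1) div 2 \<le> hdist x y'" if "x \<in> A" "y' \<in> map Not ` B" for x y'
  proof -
    from that obtain y where y: "y \<in> B" "y' = map Not y"
      by auto
    have len: "length x = k" "length y = k"
      using that y assms(1,2) by (auto simp: cube_def)
    moreover have "\<not> halves_far k (x @ y)"
      using assms(3) that(1) y(1) False by auto
    ultimately have "2 * hdist x y \<le> k"
      by (simp add: halves_far_def)
    with hdist_map_Not[of x y] len y show ?thesis
      by auto
  qed
  moreover have "map Not ` B \<subseteq> cube k"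
    using assms(2) by (auto simp: cube_def)
  ultimately show ?thesis
    using card_mult_card_le_of_hdist[OF assms(1), of "map Not ` B" "(k + 1) div 2"] card by auto
qed

lemma power_power_swap: "((a :: 'a :: monoid_mult) ^ m) ^ n = (a ^ n) ^ m"
  by (simp only: power_mult[symmetric] mult.commute)

text \<open>The whole cube contains a monochromatic square of side \<open>s\<close>, about
  \<open>2 ^ k / l\<close>, so \<open>s ^ 4 * 3 ^ k \<le> (256 / 9) ^ k\<close>. Fourth powers keep
  all bases rational, and \<open>16 * 3 = 27 / 16 * (256 / 9)\<close>.\<close>

lemma halves_far_decision_list_length:
  assumes "linear_decision_list_computes (2 * k) D (halves_far k)" "length D \<le> 2 ^ k"
  shows "(27 / 16 :: real) ^ k \<le> (2 * real (length D)) ^ 4"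
proof -
  define l where "l = length D"
  define s where "s = 2 ^ k div l"
  have D: "D \<noteq> []" "\<forall>p\<in>set D. is_LTF (k + k) (fst p)" "\<forall>z\<in>cube (k + k). fst (last D) z"
    "\<forall>z\<in>cube (k + k). decision_list_eval D z = halves_far k z"
    using assms(1)
    by (auto simp: linear_decision_list_computes_def is_linear_decision_list_def mult_2)
  have l: "0 < l" "l \<le> 2 ^ k"
    using D(1) assms(2) by (auto simp: l_def)
  have app: "x @ y \<in> cube (k + k)" if "x \<in> cube k" "y \<in> cube k" for x y
    using that by (auto simp: cube_def)
  have "\<exists>A B v. A \<subseteq> cube k \<and> B \<subseteq> cube k \<and> card A = s \<and> card B = s \<and>
      (\<forall>x\<in>A. \<forall>y\<in>B. decision_list_eval D (x @ y) = v)"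
  proof (rule decision_list_monochromatic_rectangle[OF D(1)])
    show "\<forall>x\<in>cube k. \<forall>y\<in>cube k. \<exists>p\<in>set D. fst p (x @ y)"
      using D(1,3) app last_in_set by blast
  qed (use D(2) in \<open>auto simp: card_cube s_def l_def\<close>)
  then obtain A B v where AB: "A \<subseteq> cube k" "B \<subseteq> cube k" "card A = s" "card B = s"
    "\<forall>x\<in>A. \<forall>y\<in>B. decision_list_eval D (x @ y) = v"
    by blast
  then have "\<forall>x\<in>A. \<forall>y\<in>B. halves_far k (x @ y) = v"
    using D(4) app by (metis subsetD)
  from halves_far_monochromatic_rectangle[OF AB(1,2) this]
  have "real s * real s * 3 ^ ((k + 1) div 2) \<le> (16 / 3) ^ k"
    by (simp add: AB)
  \<comment> \<open>Squaring removes the rounding, since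
    \<open>2 * ((k + 1) div 2) \<ge> k\<close>.\<close>
  then have "(real s * real s * 3 ^ ((k + 1) div 2))\<^sup>2 \<le> ((16 / 3) ^ k)\<^sup>2"
    by (rule power_mono) auto
  then have "real s ^ 4 * 3 ^ (2 * ((k + 1) div 2)) \<le> ((16 / 3) ^ k)\<^sup>2"
    by (simp add: power_even_eq power4_eq_xxxx power2_eq_square mult_ac
        del: power_Suc power_mult_numeral)
  moreover have "real s ^ 4 * 3 ^ k \<le> real s ^ 4 * 3 ^ (2 * ((k + 1) div 2))"
    by (intro mult_left_mono power_increasing) auto
  moreover have "((16 / 3 :: real) ^ k)\<^sup>2 = (256 / 9) ^ k"
    by (subst power_power_swap) (simp add: power2_eq_square)
  ultimately have s4: "real s ^ 4 * 3 ^ k \<le> (256 / 9) ^ k"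
    by linarith
  have "2 ^ k = l * s + 2 ^ k mod l"
    by (simp add: s_def)
  \<comment> \<open>As \<open>l \<le> 2 ^ k\<close>, \<open>s\<close> is positive and the remainder
    is below \<open>l * s\<close>.\<close>
  moreover have "2 ^ k mod l < l" "l * 1 \<le> l * s"
    using l by (auto simp: s_def div_greater_zero_iff Suc_le_eq)
  ultimately have "2 ^ k \<le> 2 * l * s"
    by linarith
  then have "real (2 ^ k) \<le> real (2 * l * s)"
    by (simp only: of_nat_le_iff)
  then have "(2 ^ k) ^ 4 \<le> (2 * real l * real s) ^ 4"
    by (intro power_mono) auto
  then have "16 ^ k \<le> (2 * real l) ^ 4 * real s ^ 4"
    by (simp add: power_power_swap[of _ k 4] power_mult_distrib)
  then have "16 ^ k * 3 ^ k \<le> (2 * real l) ^ 4 * (real s ^ 4 * 3 ^ k)"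
    by (simp only: mult.assoc[symmetric]) (rule mult_right_mono, auto)
  also have "\<dots> \<le> (2 * real l) ^ 4 * (256 / 9) ^ k"
    using s4 by (intro mult_left_mono) auto
  finally have "(27 / 16 * (256 / 9)) ^ k \<le> (2 * real l) ^ 4 * (256 / 9) ^ k"
    by (simp add: power_mult_distrib[symmetric])
  then have "(27 / 16) ^ k * (256 / 9) ^ k \<le> (2 * real l) ^ 4 * (256 / 9) ^ k"
    by (simp only: power_mult_distrib)
  then show ?thesis
    by (simp add: l_def)
qed

lemma halves_far_decision_list_exponential:
  assumes "linear_decision_list_computes (2 * k) D (halves_far k)" "16 \<le> k"
  shows "2 powr (1 / 16 * real (2 * k)) \<le> real (length D)"
proof -
  have l: "0 < real (length D)"
    using assms(1) by (auto simp: linear_decision_list_computes_def is_linear_decision_list_def)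
  have "2 ^ k \<le> real (length D) ^ 8"
  proof (cases "length D \<le> 2 ^ k")
    case True
    \<comment> \<open>Squaring the length bound gives
      \<open>(27 / 16)\<^sup>2 = 2 * (729 / 512)\<close> as base and a factor
      \<open>2 ^ 8 = 256\<close> on the right; from \<open>k = 16\<close> on,
      \<open>(729 / 512) ^ k\<close> absorbs that factor.\<close>
    have "256 * 2 ^ k \<le> (729 / 512 :: real) ^ 16 * 2 ^ k"
      by (intro mult_right_mono) (auto simp: power_divide)
    also have "\<dots> \<le> (729 / 512) ^ k * 2 ^ k"
      using assms(2) by (intro mult_right_mono power_increasing) auto
    also have "\<dots> = ((27 / 16) ^ k)\<^sup>2"
      by (subst power_power_swap) (simp add: power2_eq_square power_mult_distrib[symmetric])
    also have "\<dots> \<le> ((2 * real (length D)) ^ 4)\<^sup>2"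
      using halves_far_decision_list_length[OF assms(1) True] by (rule power_mono) auto
    finally show ?thesis
      by (simp add: power_mult_distrib power_mult[symmetric])
  next
    case False
    then have "real (2 ^ k) \<le> real (length D)"
      by (simp only: of_nat_le_iff)
    also have "\<dots> \<le> real (length D) ^ 8"
      using l by (intro self_le_power) (auto simp: Suc_le_eq)
    finally show ?thesis
      by simp
  qed
  \<comment> \<open>Eighth roots give the exponent \<open>k / 8\<close>, which is
    \<open>1 / 16\<close> of the number \<open>2 * k\<close> of variables.\<close>
  then have "(2 ^ k) powr (1 / 8) \<le> (real (length D) ^ 8) powr (1 / 8)"
    by (intro powr_mono2) auto
  moreover have "(real (length D) ^ 8) powr (1 / 8) = real (length D)"
    using l by (simp only: powr_realpow[symmetric] powr_powr) simp
  moreover have "(2 ^ k) powr (1 / 8) = 2 powr (1 / 16 * real (2 * k))"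
    by (simp only: powr_realpow[symmetric] powr_powr zero_less_numeral) simp
  ultimately show ?thesis
    by (simp only:)
qed

theorem corollary2:
  "\<exists>(N :: nat \<Rightarrow> nat) (f :: nat \<Rightarrow> bool list \<Rightarrow> bool).
     strict_mono_on {1..} N \<and>
     (\<exists>p :: nat poly. \<forall>k\<ge>1. \<exists>C.
        circuit_computes (N k) C (f k) \<and> circuit_size C \<le> poly p (N k)) \<and>
     (\<exists>c>0. \<forall>\<^sub>F k in sequentially. \<forall>D.
        linear_decision_list_computes (N k) D (f k) \<longrightarrow>
        2 powr (c * real (N k)) \<le> real (length D))"
proof (intro exI conjI)
  show "strict_mono_on {1..} (\<lambda>k :: nat. 2 * k)"
    by (auto simp: strict_mono_on_def)
  \<comment> \<open>The polynomial \<open>5 * X\<close> takes the value \<open>10 * k\<close> at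
    \<open>2 * k\<close>, above the circuit size \<open>9 * k\<close>.\<close>
  show "\<forall>k\<ge>1. \<exists>C. circuit_computes (2 * k) C (halves_far k) \<and> circuit_size C \<le> poly [:0, 5:] (2 * k)"
  proof (intro allI impI exI conjI)
    show "circuit_computes (2 * k) (far_circuit k) (halves_far k)" for k
      by (rule circuit_computes_far)
  qed (simp add: circuit_size_far)
  show "(1 / 16 :: real) > 0"
    by simp
  show "\<forall>\<^sub>F k in sequentially. \<forall>D. linear_decision_list_computes (2 * k) D (halves_far k) \<longrightarrow>
      2 powr (1 / 16 * real (2 * k)) \<le> real (length D)"
    using eventually_ge_at_top[of 16]
    by eventually_elim (use halves_far_decision_list_exponential in blast)
qed

end
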